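(* The two Poisson brackets $\{\cdot,\cdot\}$ and $\{\cdot,\cdot\}_0$ (defined in the context) on the algebra of functions generated by the coordinates $\{\operatorname{Re}\alpha_n,\operatorname{Im}\alpha_n:n\in\mathbb Z\}$ are compatible; that is, every linear combination $\lambda\{\cdot,\cdot\}+\mu\{\cdot,\cdot\}_0$ with $\lambda,\mu\in\mathbb R$ is again a Poisson bracket (in particular it satisfies the Jacobi identity).
   Context: Work on the algebra of functions of finitely many of the independent complex variables $\alpha_n\in\mathbb C$, $n\in\mathbb Z$ (generated by $\operatorname{Re}\alpha_n,\operatorname{Im}\alpha_n$). Both brackets are antisymmetric bi-derivations, determined by their values on generators. First bracket: $$\{\operatorname{Re}\alpha_n,\operatorname{Im}\alpha_m\}=\begin{cases} -\frac{1+|\alpha_m|^2}{2}\operatorname{Im}\alpha_n\operatorname{Im}(\alpha_{m-1}-\alpha_{m+1}),& n\ge m+2,\\[1ex] -\frac{1+|\alpha_m|^2}{2}\Bigl[\operatorname{Im}\alpha_n\operatorname{Im}(\alpha_{m-1}-\alpha_{m+1})+\frac{1+|\alpha_n|^2}{2}\Bigr],& n=m+1,\\[1ex] \frac{1+|\alpha_n|^2}{2}-\frac{1+|\alpha_n|^2}{2}\operatorname{Re}(\alpha_n\overline{\alpha_{n-1}}),& n=m,\\[1ex] -\frac{1+|\alpha_n|^2}{2}\Bigl[\operatorname{Re}\alpha_m\operatorname{Re}(\alpha_{n-1}-\alpha_{n+1})+\frac{1+|\alpha_m|^2}{2}\Bigr],& n=m-1,\\[1ex] -\frac{1+|\alpha_n|^2}{2}\operatorname{Re}\alpha_m\operatorname{Re}(\alpha_{n-1}-\alpha_{n+1}),&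 n\le m-2, \end{cases}$$ and for $n\ge m+1$ $$\{\operatorname{Re}\alpha_n,\operatorname{Re}\alpha_m\}=-\tfrac{1+|\alpha_m|^2}{2}\operatorname{Im}\alpha_n\operatorname{Re}(\alpha_{m-1}-\alpha_{m+1}),\quad \{\operatorname{Im}\alpha_n,\operatorname{Im}\alpha_m\}=\tfrac{1+|\alpha_m|^2}{2}\operatorname{Re}\alpha_n\operatorname{Im}(\alpha_{m-1}-\alpha_{m+1}),$$ with all remaining cases determined by antisymmetry. Second bracket: $\{\operatorname{Re}\alpha_n,\operatorname{Im}\alpha_m\}_0=-\{\operatorname{Im}\alpha_n,\operatorname{Re}\alpha_m\}_0=(1+|\alpha_n|^2)\delta_{nm}$, and all other brackets of generators are zero. *)

theory Defs
  imports "HOL-Analysis.Analysis"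
begin

text \<open>A point is a bi-infinite sequence \<open>\<alpha> :: int \<Rightarrow> complex\<close> of independent complex variables.\<close>

type_synonym observable = "(int \<Rightarrow> complex) \<Rightarrow> real"

datatype gen = ReG int | ImG int

fun coord :: "gen \<Rightarrow> observable" where
  "coord (ReG n) \<alpha> = Re (\<alpha> n)"
| "coord (ImG n) \<alpha> = Im (\<alpha> n)"

text \<open>
  The real algebra generated by the coordinates: real polynomial functions of finitely many of the
  \<open>Re (\<alpha> n)\<close>, \<open>Im (\<alpha> n)\<close>. On it a bi-derivation is determined by its values on the generators.\<close>

inductive_set coord_algebra :: "observable set" where
  const: "(\<lambda>_. c) \<in> coord_algebra"
| gen: "coord u \<in> coord_algebra"
| add: "f \<in> coord_algebra \<Longrightarrow> g \<in> coord_algebra \<Longrightarrow> (\<lambda>\<alpha>. f \<alpha> + g \<alpha>) \<in> coord_algebra"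
| mult: "f \<in> coord_algebra \<Longrightarrow> g \<in> coord_algebra \<Longrightarrow> (\<lambda>\<alpha>. f \<alpha> * g \<alpha>) \<in> coord_algebra"

text \<open>By antisymmetry, linearity and the Leibniz rule are only required in the first argument.\<close>

definition antisym_biderivation_on ::
  "('a \<Rightarrow> real) set \<Rightarrow> (('a \<Rightarrow> real) \<Rightarrow> ('a \<Rightarrow> real) \<Rightarrow> ('a \<Rightarrow> real)) \<Rightarrow> bool" where
  "antisym_biderivation_on A B \<longleftrightarrow>
     (\<forall>f\<in>A. \<forall>g\<in>A. B f g \<in> A) \<and>
     (\<forall>f\<in>A. \<forall>g\<in>A. \<forall>x. B f g x = - B g f x) \<and>
     (\<forall>f\<in>A. \<forall>g\<in>A. \<forall>h\<in>A. \<forall>x. B (\<lambda>y. f y + g y) h x = B f h x + B g h x) \<and>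
     (\<forall>c. \<forall>f\<in>A. \<forall>h\<in>A. \<forall>x. B (\<lambda>y. c * f y) h x = c * B f h x) \<and>
     (\<forall>f\<in>A. \<forall>g\<in>A. \<forall>h\<in>A. \<forall>x. B (\<lambda>y. f y * g y) h x = f x * B g h x + g x * B f h x)"

definition poisson_bracket_on ::
  "('a \<Rightarrow> real) set \<Rightarrow> (('a \<Rightarrow> real) \<Rightarrow> ('a \<Rightarrow> real) \<Rightarrow> ('a \<Rightarrow> real)) \<Rightarrow> bool" where
  "poisson_bracket_on A B \<longleftrightarrow>
     antisym_biderivation_on A B \<and>
     (\<forall>f\<in>A. \<forall>g\<in>A. \<forall>h\<in>A. \<forall>x. B f (B g h) x + B g (B h f) x + B h (B f g) x = 0)"

text \<open>The choices \<open>(l, m) = (1, 0)\<close> and \<open>(0, 1)\<close> include that both brackets are Poisson.\<close>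

definition compatible_on ::
  "('a \<Rightarrow> real) set \<Rightarrow> (('a \<Rightarrow> real) \<Rightarrow> ('a \<Rightarrow> real) \<Rightarrow> ('a \<Rightarrow> real)) \<Rightarrow>
   (('a \<Rightarrow> real) \<Rightarrow> ('a \<Rightarrow> real) \<Rightarrow> ('a \<Rightarrow> real)) \<Rightarrow> bool" where
  "compatible_on A B C \<longleftrightarrow>
     (\<forall>l m :: real. poisson_bracket_on A (\<lambda>f g x. l * B f g x + m * C f g x))"

fun set_coord :: "gen \<Rightarrow> real \<Rightarrow> (int \<Rightarrow> complex) \<Rightarrow> (int \<Rightarrow> complex)" where
  "set_coord (ReG n) t \<alpha> = \<alpha>(n := Complex t (Im (\<alpha> n)))"
| "set_coord (ImG n) t \<alpha> = \<alpha>(n := Complex (Re (\<alpha> n)) t)"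

definition partial :: "gen \<Rightarrow> observable \<Rightarrow> observable" where
  "partial u f \<alpha> = deriv (\<lambda>t. f (set_coord u t \<alpha>)) (coord u \<alpha>)"

definition active :: "observable \<Rightarrow> gen set" where
  "active f = {u. partial u f \<noteq> (\<lambda>_. 0)}"

text \<open>
  The coordinate expression of the bi-derivation with values \<open>W u v\<close> on the generators. The sums
  are finite on the algebra; see \<open>biderivation_spec\<close> and \<open>biderivation_unique\<close> below for the proof
  that it is the one and only antisymmetric bi-derivation with these values.\<close>

definition biderivation :: "(gen \<Rightarrow> gen \<Rightarrow> observable) \<Rightarrow> observable \<Rightarrow> observable \<Rightarrow> observable" where
  "biderivation W f g \<alpha> =
     (\<Sum>u\<in>active f. \<Sum>v\<in>active g. W u v \<alpha> * partial u f \<alpha> * partial v g \<alpha>)"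

definition val_Re_Im :: "int \<Rightarrow> int \<Rightarrow> observable" where
  "val_Re_Im n m \<alpha> =
     (if n \<ge> m + 2 then
        - ((1 + (cmod (\<alpha> m))\<^sup>2) / 2) * (Im (\<alpha> n) * Im (\<alpha> (m - 1) - \<alpha> (m + 1)))
      else if n = m + 1 then
        - ((1 + (cmod (\<alpha> m))\<^sup>2) / 2) *
          (Im (\<alpha> n) * Im (\<alpha> (m - 1) - \<alpha> (m + 1)) + (1 + (cmod (\<alpha> n))\<^sup>2) / 2)
      else if n = m then
        (1 + (cmod (\<alpha> n))\<^sup>2) / 2 - (1 + (cmod (\<alpha> n))\<^sup>2) / 2 * Re (\<alpha> n * cnj (\<alpha> (n - 1)))
      else if n = m - 1 then
        - ((1 + (cmod (\<alpha> n))\<^sup>2) / 2) *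
          (Re (\<alpha> m) * Re (\<alpha> (n - 1) - \<alpha> (n + 1)) + (1 + (cmod (\<alpha> m))\<^sup>2) / 2)
      else
        - ((1 + (cmod (\<alpha> n))\<^sup>2) / 2) * (Re (\<alpha> m) * Re (\<alpha> (n - 1) - \<alpha> (n + 1))))"

definition val_Re_Re :: "int \<Rightarrow> int \<Rightarrow> observable" where
  "val_Re_Re n m \<alpha> = - ((1 + (cmod (\<alpha> m))\<^sup>2) / 2) * Im (\<alpha> n) * Re (\<alpha> (m - 1) - \<alpha> (m + 1))"

definition val_Im_Im :: "int \<Rightarrow> int \<Rightarrow> observable" where
  "val_Im_Im n m \<alpha> = (1 + (cmod (\<alpha> m))\<^sup>2) / 2 * Re (\<alpha> n) * Im (\<alpha> (m - 1) - \<alpha> (m + 1))"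

text \<open>\<open>val_Re_Re n m\<close> and \<open>val_Im_Im n m\<close> are the values of the bracket only for \<open>n \<ge> m + 1\<close>.\<close>

fun gen_bracket :: "gen \<Rightarrow> gen \<Rightarrow> observable" where
  "gen_bracket (ReG n) (ImG m) \<alpha> = val_Re_Im n m \<alpha>"
| "gen_bracket (ImG n) (ReG m) \<alpha> = - val_Re_Im m n \<alpha>"
| "gen_bracket (ReG n) (ReG m) \<alpha> =
     (if n \<ge> m + 1 then val_Re_Re n m \<alpha> else if m \<ge> n + 1 then - val_Re_Re m n \<alpha> else 0)"
| "gen_bracket (ImG n) (ImG m) \<alpha> =
     (if n \<ge> m + 1 then val_Im_Im n m \<alpha> else if m \<ge> n + 1 then - val_Im_Im m n \<alpha> else 0)"

fun gen_bracket0 :: "gen \<Rightarrow> gen \<Rightarrow> observable" where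
  "gen_bracket0 (ReG n) (ImG m) \<alpha> = (if n = m then 1 + (cmod (\<alpha> n))\<^sup>2 else 0)"
| "gen_bracket0 (ImG n) (ReG m) \<alpha> = (if n = m then - (1 + (cmod (\<alpha> n))\<^sup>2) else 0)"
| "gen_bracket0 (ReG n) (ReG m) \<alpha> = 0"
| "gen_bracket0 (ImG n) (ImG m) \<alpha> = 0"

definition bracket :: "observable \<Rightarrow> observable \<Rightarrow> observable" where
  "bracket = biderivation gen_bracket"

definition bracket0 :: "observable \<Rightarrow> observable \<Rightarrow> observable" where
  "bracket0 = biderivation gen_bracket0"

lemma set_coord_same [simp]: "set_coord u (coord u \<alpha>) \<alpha> = \<alpha>"
  by (cases u) auto

lemma coord_set_coord: "coord v (set_coord u t \<alpha>) = (if u = v then t else coord v \<alpha>)"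
  by (cases u; cases v) auto

lemma algebra_differentiable:
  "f \<in> coord_algebra \<Longrightarrow> (\<lambda>t. f (set_coord u t \<alpha>)) field_differentiable at x"
proof (induction rule: coord_algebra.induct)
  case (gen v)
  show ?case
    by (cases "u = v") (auto simp: coord_set_coord)
qed (auto intro: field_differentiable_add field_differentiable_mult)

lemma partial_const [simp]: "partial u (\<lambda>_. c) = (\<lambda>_. 0)"
  by (auto simp: partial_def)

lemma partial_gen: "partial u (coord v) = (\<lambda>_. if u = v then 1 else 0)"
  by (cases "u = v") (auto simp: partial_def coord_set_coord fun_eq_iff)

lemma partial_add:
  assumes "f \<in> coord_algebra" "g \<in> coord_algebra"
  shows "partial u (\<lambda>\<alpha>. f \<alpha> + g \<alpha>) = (\<lambda>\<alpha>. partial u f \<alpha> + partial u g \<alpha>)"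
  using assms by (auto simp: partial_def fun_eq_iff algebra_differentiable)

lemma partial_mult:
  assumes "f \<in> coord_algebra" "g \<in> coord_algebra"
  shows "partial u (\<lambda>\<alpha>. f \<alpha> * g \<alpha>) = (\<lambda>\<alpha>. f \<alpha> * partial u g \<alpha> + partial u f \<alpha> * g \<alpha>)"
  using assms by (auto simp: partial_def fun_eq_iff algebra_differentiable)

lemma partial_in_algebra: "f \<in> coord_algebra \<Longrightarrow> partial u f \<in> coord_algebra"
  by (induction rule: coord_algebra.induct)
     (simp_all add: partial_gen partial_add partial_mult coord_algebra.intros)

lemma finite_active: "f \<in> coord_algebra \<Longrightarrow> finite (active f)"
proof (induction rule: coord_algebra.induct)
  case (const c)
  then show ?case by (simp add: active_def)
next
  case (gen v)
  have "active (coord v) \<subseteq> {v}"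
    by (auto simp: active_def partial_gen fun_eq_iff split: if_splits)
  then show ?case using finite_subset by blast
next
  case (add f g)
  then have "active (\<lambda>\<alpha>. f \<alpha> + g \<alpha>) \<subseteq> active f \<union> active g"
    by (auto simp: active_def partial_add)
  then show ?case using add finite_subset by blast
next
  case (mult f g)
  then have "active (\<lambda>\<alpha>. f \<alpha> * g \<alpha>) \<subseteq> active f \<union> active g"
    by (auto simp: active_def partial_mult)
  then show ?case using mult finite_subset by blast
qed

lemma biderivation_superset:
  assumes "finite F" "finite G" "active f \<subseteq> F" "active g \<subseteq> G"
  shows "biderivation W f g \<alpha> = (\<Sum>u\<in>F. \<Sum>v\<in>G. W u v \<alpha> * partial u f \<alpha> * partial v g \<alpha>)"
proof -
  have z: "partial u h \<alpha> = 0" if "u \<notin> active h" for u h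
    using that by (simp add: active_def)
  have "(\<Sum>v\<in>active g. W u v \<alpha> * partial u f \<alpha> * partial v g \<alpha>)
      = (\<Sum>v\<in>G. W u v \<alpha> * partial u f \<alpha> * partial v g \<alpha>)" for u
    using assms by (intro sum.mono_neutral_left) (auto simp: z)
  then have "biderivation W f g \<alpha>
      = (\<Sum>u\<in>active f. \<Sum>v\<in>G. W u v \<alpha> * partial u f \<alpha> * partial v g \<alpha>)"
    by (simp add: biderivation_def)
  also have "\<dots> = (\<Sum>u\<in>F. \<Sum>v\<in>G. W u v \<alpha> * partial u f \<alpha> * partial v g \<alpha>)"
    using assms by (intro sum.mono_neutral_left) (auto simp: z)
  finally show ?thesis .
qed

lemma algebra_sum:
  assumes "finite F" "\<And>u. u \<in> F \<Longrightarrow> f u \<in> coord_algebra"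
  shows "(\<lambda>\<alpha>. \<Sum>u\<in>F. f u \<alpha>) \<in> coord_algebra"
  using assms
  by (induction F) (auto intro: coord_algebra.intros)

lemma algebra_scale: "f \<in> coord_algebra \<Longrightarrow> (\<lambda>\<alpha>. c * f \<alpha>) \<in> coord_algebra"
  using coord_algebra.mult[OF coord_algebra.const] by simp

theorem biderivation_spec:
  assumes W: "\<And>u v. W u v \<in> coord_algebra" and anti: "\<And>u v \<alpha>. W u v \<alpha> = - W v u \<alpha>"
  shows "antisym_biderivation_on coord_algebra (biderivation W)"
    and "biderivation W (coord u) (coord v) = W u v"
proof -
  have closed: "biderivation W f g \<in> coord_algebra"
    if "f \<in> coord_algebra" "g \<in> coord_algebra" for f g
  proof -
    have "(\<lambda>\<alpha>. \<Sum>u\<in>active f. \<Sum>v\<in>active g. W u v \<alpha> * partial u f \<alpha> * partial v g \<alpha>) \<in> coord_algebra"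
      using that by (intro algebra_sum finite_active coord_algebra.mult W partial_in_algebra)
    then show ?thesis by (simp add: biderivation_def[abs_def])
  qed
  have antisym: "biderivation W f g \<alpha> = - biderivation W g f \<alpha>" for f g \<alpha>
  proof -
    have "biderivation W g f \<alpha>
        = (\<Sum>v\<in>active f. \<Sum>u\<in>active g. W u v \<alpha> * partial u g \<alpha> * partial v f \<alpha>)"
      unfolding biderivation_def by (rule sum.swap)
    also have "\<dots> = (\<Sum>v\<in>active f. \<Sum>u\<in>active g. - (W v u \<alpha> * partial v f \<alpha> * partial u g \<alpha>))"
      by (intro sum.cong refl) (subst anti, simp)
    also have "\<dots> = - biderivation W f g \<alpha>"
      by (simp add: biderivation_def sum_negf)
    finally show ?thesis by simp
  qed
  have add: "biderivation W (\<lambda>y. f y + g y) h \<alpha> = biderivation W f h \<alpha> + biderivation W g h \<alpha>"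
   and mult: "biderivation W (\<lambda>y. f y * g y) h \<alpha>
                = f \<alpha> * biderivation W g h \<alpha> + g \<alpha> * biderivation W f h \<alpha>"
    if fg: "f \<in> coord_algebra" "g \<in> coord_algebra" "h \<in> coord_algebra" for f g h \<alpha>
  proof -
    let ?F = "active f \<union> active g"
    have fin: "finite ?F" "finite (active h)"
      using fg by (auto simp: finite_active)
    have sub: "active (\<lambda>y. f y + g y) \<subseteq> ?F" "active (\<lambda>y. f y * g y) \<subseteq> ?F"
      using fg by (auto simp: active_def partial_add partial_mult)
    note sup = biderivation_superset[OF fin _ order_refl]
    show "biderivation W (\<lambda>y. f y + g y) h \<alpha> = biderivation W f h \<alpha> + biderivation W g h \<alpha>"
      using sub fg by (simp add: sup partial_add algebra_simps sum.distrib)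
    show "biderivation W (\<lambda>y. f y * g y) h \<alpha>
                = f \<alpha> * biderivation W g h \<alpha> + g \<alpha> * biderivation W f h \<alpha>"
      using sub fg by (simp add: sup partial_mult algebra_simps sum.distrib sum_distrib_left)
  qed
  have "biderivation W (\<lambda>y. c * f y) h \<alpha> = c * biderivation W f h \<alpha>"
    if "f \<in> coord_algebra" "h \<in> coord_algebra" for c f h \<alpha>
    using mult[OF coord_algebra.const[of c] that(1,2)]
    by (simp add: biderivation_def[of W "\<lambda>_. c"])
  with closed antisym add mult show "antisym_biderivation_on coord_algebra (biderivation W)"
    unfolding antisym_biderivation_on_def by blast
  have "active (coord w) \<subseteq> {w}" for w
    by (auto simp: active_def partial_gen fun_eq_iff split: if_splits)
  then show "biderivation W (coord u) (coord v) = W u v"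
    by (simp add: biderivation_superset[of "{u}" "{v}"] partial_gen fun_eq_iff)
qed

theorem biderivation_unique:
  assumes B: "antisym_biderivation_on coord_algebra B"
      and C: "antisym_biderivation_on coord_algebra C"
      and gen: "\<And>u v. B (coord u) (coord v) = C (coord u) (coord v)"
      and f: "f \<in> coord_algebra" and g: "g \<in> coord_algebra"
  shows "B f g = C f g"
proof -
  have const_zero: "D (\<lambda>_. c) h x = 0"
    if D: "antisym_biderivation_on coord_algebra D" and h: "h \<in> coord_algebra" for D c h x
  proof -
    have leibniz: "D (\<lambda>y. p y * q y) h x = p x * D q h x + q x * D p h x"
      and scale: "D (\<lambda>y. c * p y) h x = c * D p h x"
      if "p \<in> coord_algebra" "q \<in> coord_algebra" for p q
      using D h that unfolding antisym_biderivation_on_def by blast+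
    show ?thesis
      using leibniz[OF coord_algebra.const[of 1] coord_algebra.const[of 1]]
        scale[OF coord_algebra.const[of 1] coord_algebra.const[of 1]] by simp
  qed
  have ext: "\<forall>x. B k h x = C k h x"
    if h: "h \<in> coord_algebra" and k: "k \<in> coord_algebra"
      and base: "\<And>u x. B (coord u) h x = C (coord u) h x" for h k
    using k
  proof (induction rule: coord_algebra.induct)
    case (const c)
    then show ?case using const_zero[OF B h] const_zero[OF C h] by simp
  next
    case (gen u)
    then show ?case using base by simp
  next
    case (add p q)
    have "D (\<lambda>y. p y + q y) h x = D p h x + D q h x"
      if "antisym_biderivation_on coord_algebra D" for D x
      using that add.hyps h unfolding antisym_biderivation_on_def by blast
    from this[OF B] this[OF C] add.IH show ?case by simp
  next
    case (mult p q)
    have "D (\<lambda>y. p y * q y) h x = p x * D q h x + q x * D p h x"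
      if "antisym_biderivation_on coord_algebra D" for D x
      using that mult.hyps h unfolding antisym_biderivation_on_def by blast
    from this[OF B] this[OF C] mult.IH show ?case by simp
  qed
  have anti: "D p q x = - D q p x"
    if "antisym_biderivation_on coord_algebra D" "p \<in> coord_algebra" "q \<in> coord_algebra" for D p q x
    using that unfolding antisym_biderivation_on_def by blast
  have "B (coord u) g x = C (coord u) g x" for u x
  proof -
    have "B g (coord u) x = C g (coord u) x"
      using ext[OF coord_algebra.gen g] gen by simp
    then show ?thesis
      using anti[OF B coord_algebra.gen g] anti[OF C coord_algebra.gen g] by simp
  qed
  then show ?thesis using ext[OF g f] by blast
qed

lemma algebra_Re: "(\<lambda>\<alpha>. Re (\<alpha> n)) \<in> coord_algebra"
  using coord_algebra.gen[of "ReG n"] by (simp add: coord.simps[abs_def])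

lemma algebra_Im: "(\<lambda>\<alpha>. Im (\<alpha> n)) \<in> coord_algebra"
  using coord_algebra.gen[of "ImG n"] by (simp add: coord.simps[abs_def])

lemma algebra_uminus: "f \<in> coord_algebra \<Longrightarrow> (\<lambda>\<alpha>. - f \<alpha>) \<in> coord_algebra"
  using algebra_scale[of f "-1"] by simp

lemma algebra_diff:
  "f \<in> coord_algebra \<Longrightarrow> g \<in> coord_algebra \<Longrightarrow> (\<lambda>\<alpha>. f \<alpha> - g \<alpha>) \<in> coord_algebra"
  using coord_algebra.add[OF _ algebra_uminus] by simp

lemma algebra_divide: "f \<in> coord_algebra \<Longrightarrow> (\<lambda>\<alpha>. f \<alpha> / c) \<in> coord_algebra"
  using algebra_scale[of f "1 / c"] by simp

lemma algebra_square: "f \<in> coord_algebra \<Longrightarrow> (\<lambda>\<alpha>. (f \<alpha>)\<^sup>2) \<in> coord_algebra"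
  using coord_algebra.mult by (simp add: power2_eq_square)

lemma algebra_if:
  "f \<in> coord_algebra \<Longrightarrow> g \<in> coord_algebra \<Longrightarrow> (\<lambda>\<alpha>. if P then f \<alpha> else g \<alpha>) \<in> coord_algebra"
  by (cases P) simp_all

lemma algebra_cmod: "(\<lambda>\<alpha>. (cmod (\<alpha> n))\<^sup>2) \<in> coord_algebra"
  unfolding cmod_power2 by (intro coord_algebra.add algebra_square algebra_Re algebra_Im)

lemmas algebra_intros = algebra_if algebra_cmod coord_algebra.const coord_algebra.add coord_algebra.mult
  algebra_Re algebra_Im algebra_uminus algebra_diff algebra_divide algebra_square

lemma gen_bracket_in_algebra: "gen_bracket u v \<in> coord_algebra"
proof -
  have Re_Im: "(\<lambda>\<alpha>. val_Re_Im n m \<alpha>) \<in> coord_algebra" for n m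
    unfolding val_Re_Im_def minus_complex.sel times_complex.sel cnj.sel
    by (rule algebra_intros)+
  have Re_Re: "(\<lambda>\<alpha>. val_Re_Re n m \<alpha>) \<in> coord_algebra" for n m
    unfolding val_Re_Re_def minus_complex.sel
    by (rule algebra_intros)+
  have Im_Im: "(\<lambda>\<alpha>. val_Im_Im n m \<alpha>) \<in> coord_algebra" for n m
    unfolding val_Im_Im_def minus_complex.sel
    by (rule algebra_intros)+
  have "(\<lambda>\<alpha>. gen_bracket u v \<alpha>) \<in> coord_algebra"
    by (cases u; cases v; simp only: gen_bracket.simps)
       (rule Re_Im Re_Re Im_Im algebra_intros)+
  then show ?thesis .
qed

lemma gen_bracket0_in_algebra: "gen_bracket0 u v \<in> coord_algebra"
proof -
  have "(\<lambda>\<alpha>. gen_bracket0 u v \<alpha>) \<in> coord_algebra"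
    by (cases u; cases v; simp only: gen_bracket0.simps) (rule algebra_intros)+
  then show ?thesis .
qed

lemma gen_bracket_antisym: "gen_bracket u v \<alpha> = - gen_bracket v u \<alpha>"
  by (cases u; cases v) auto

lemma gen_bracket0_antisym: "gen_bracket0 u v \<alpha> = - gen_bracket0 v u \<alpha>"
  by (cases u; cases v) auto

theorem bracket_spec:
  shows "antisym_biderivation_on coord_algebra bracket"
    and "bracket (coord u) (coord v) = gen_bracket u v"
    and "antisym_biderivation_on coord_algebra bracket0"
    and "bracket0 (coord u) (coord v) = gen_bracket0 u v"
  unfolding bracket_def bracket0_def
  using biderivation_spec[of gen_bracket] biderivation_spec[of gen_bracket0]
    gen_bracket_in_algebra gen_bracket0_in_algebra gen_bracket_antisym gen_bracket0_antisym
  by blast+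

end

theory Submission
  imports Defs
begin

text \<open>
  Every combination of the two brackets has one shape: for indices \<open>n > m\<close> it is \<open>l\<close> times \<open>R\<^sub>n \<and> V\<^sub>m\<close> with \<open>R\<^sub>n\<close> the rotation and \<open>V\<^sub>m\<close> the Ablowitz--Ladik (Schur) field
  \<open>(1 + |\<alpha>\<^sub>m|\<^sup>2)/2 (\<alpha>\<^sub>m\<^sub>-\<^sub>1 - \<alpha>\<^sub>m\<^sub>+\<^sub>1)\<close>, corrected by multiples of the area form for \<open>|n - m| \<le> 1\<close>; the second
  bracket only shifts the constant \<open>c\<close> in the diagonal term. So it is enough to prove the Jacobi
  identity for one family with free parameters \<open>l\<close> and \<open>c\<close>. The Jacobiator is an antisymmetric
  derivation in each argument, which reduces the identity to generators sorted by index, where only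
  finitely many configurations of gaps between the indices behave differently.\<close>

section \<open>Generator values of the pencil\<close>

fun idx :: "gen \<Rightarrow> int" where
  "idx (ReG n) = n"
| "idx (ImG n) = n"

definition weight :: "int \<Rightarrow> observable" where
  "weight n \<alpha> = (1 + (Re (\<alpha> n))\<^sup>2 + (Im (\<alpha> n))\<^sup>2) / 2"

definition corr :: "int \<Rightarrow> observable" where
  "corr n \<alpha> = Re (\<alpha> n) * Re (\<alpha> (n - 1)) + Im (\<alpha> n) * Im (\<alpha> (n - 1))"

fun rot :: "gen \<Rightarrow> observable" where
  "rot (ReG n) \<alpha> = - Im (\<alpha> n)"
| "rot (ImG n) \<alpha> = Re (\<alpha> n)"

fun flow :: "gen \<Rightarrow> observable" where
  "flow (ReG n) \<alpha> = weight n \<alpha> * (Re (\<alpha> (n - 1)) - Re (\<alpha> (n + 1)))"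
| "flow (ImG n) \<alpha> = weight n \<alpha> * (Im (\<alpha> (n - 1)) - Im (\<alpha> (n + 1)))"

text \<open>Indices are ignored on purpose: the same sign pattern serves a single index and
  neighbouring ones.\<close>

fun area :: "gen \<Rightarrow> gen \<Rightarrow> real" where
  "area (ReG _) (ImG _) = 1"
| "area (ImG _) (ReG _) = -1"
| "area (ReG _) (ReG _) = 0"
| "area (ImG _) (ImG _) = 0"

text \<open>Meant for \<open>idx v < idx u\<close>; \<open>pencil\<close> gets the opposite order by
  antisymmetry.\<close>

definition pencil_upper :: "real \<Rightarrow> gen \<Rightarrow> gen \<Rightarrow> observable" where
  "pencil_upper l u v \<alpha> =
     l * (rot u \<alpha> * flow v \<alpha> -
       (if idx u = idx v + 1 then area u v * (weight (idx u) \<alpha> * weight (idx v) \<alpha>) else 0))"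

definition pencil :: "real \<Rightarrow> real \<Rightarrow> gen \<Rightarrow> gen \<Rightarrow> observable" where
  "pencil l c u v \<alpha> =
     (if idx u = idx v then area u v * (weight (idx u) \<alpha> * (c - l * corr (idx u) \<alpha>))
      else if idx v < idx u then pencil_upper l u v \<alpha>
      else - pencil_upper l v u \<alpha>)"

text \<open>On the diagonal the first bracket gives weight times \<open>1 - corr\<close>, the second
  twice the weight; hence the constant \<open>l + 2 * m\<close>.\<close>

lemma pencil_eq: "l * gen_bracket u v \<alpha> + m * gen_bracket0 u v \<alpha> = pencil l (l + 2 * m) u v \<alpha>"
proof -
  have "l * gen_bracket (ReG i) (ImG j) \<alpha> + m * gen_bracket0 (ReG i) (ImG j) \<alpha>
      = pencil l (l + 2 * m) (ReG i) (ImG j) \<alpha>" for i j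
    by (simp add: pencil_def pencil_upper_def val_Re_Im_def weight_def corr_def cmod_power2 field_simps)
  moreover have "l * gen_bracket (ImG i) (ReG j) \<alpha> + m * gen_bracket0 (ImG i) (ReG j) \<alpha>
      = pencil l (l + 2 * m) (ImG i) (ReG j) \<alpha>" for i j
    by (auto simp add: pencil_def pencil_upper_def val_Re_Im_def weight_def corr_def cmod_power2 field_simps)
  ultimately show ?thesis
    by (cases u; cases v)
       (auto simp: pencil_def pencil_upper_def val_Re_Re_def val_Im_Im_def weight_def cmod_power2
         field_simps)
qed

section \<open>Differentiating the building blocks at a point\<close>

lemma weight_in_algebra: "(\<lambda>\<alpha>. weight n \<alpha>) \<in> coord_algebra"
  unfolding weight_def by (rule algebra_intros)+

lemma corr_in_algebra: "(\<lambda>\<alpha>. corr n \<alpha>) \<in> coord_algebra"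
  unfolding corr_def by (rule algebra_intros)+

lemma rot_in_algebra: "(\<lambda>\<alpha>. rot u \<alpha>) \<in> coord_algebra"
  by (cases u; simp only: rot.simps) (rule algebra_intros)+

lemma flow_in_algebra: "(\<lambda>\<alpha>. flow u \<alpha>) \<in> coord_algebra"
  by (cases u; simp only: flow.simps) (rule algebra_intros weight_in_algebra)+

lemma pencil_upper_in_algebra: "(\<lambda>\<alpha>. pencil_upper l u v \<alpha>) \<in> coord_algebra"
  unfolding pencil_upper_def
  by (rule algebra_intros weight_in_algebra rot_in_algebra flow_in_algebra)+

text \<open>Abstracts \<open>B h\<close> evaluated at one point. The Jacobi sum can then be expanded
  by the Leibniz rule from values on coordinates, without the sums and partial derivatives in
  \<open>biderivation\<close>.\<close>

locale derivation_at =
  fixes \<alpha> :: "int \<Rightarrow> complex" and D :: "observable \<Rightarrow> real"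
  assumes add: "f \<in> coord_algebra \<Longrightarrow> g \<in> coord_algebra \<Longrightarrow> D (\<lambda>\<alpha>. f \<alpha> + g \<alpha>) = D f + D g"
    and mult: "f \<in> coord_algebra \<Longrightarrow> g \<in> coord_algebra \<Longrightarrow>
      D (\<lambda>\<alpha>. f \<alpha> * g \<alpha>) = f \<alpha> * D g + g \<alpha> * D f"
    and scale: "f \<in> coord_algebra \<Longrightarrow> D (\<lambda>\<alpha>. c * f \<alpha>) = c * D f"
begin

lemma const: "D (\<lambda>_. c) = 0"
proof -
  have "D (\<lambda>_. 1 * 1) = D (\<lambda>_. 1) + D (\<lambda>_. 1)"
    using mult[OF coord_algebra.const[of 1] coord_algebra.const[of 1]] by simp
  then show ?thesis
    using scale[OF coord_algebra.const[of 1], of c] by simp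
qed

lemma uminus: "f \<in> coord_algebra \<Longrightarrow> D (\<lambda>\<alpha>. - f \<alpha>) = - D f"
  using scale[of f "-1"] by simp

lemma diff: "f \<in> coord_algebra \<Longrightarrow> g \<in> coord_algebra \<Longrightarrow> D (\<lambda>\<alpha>. f \<alpha> - g \<alpha>) = D f - D g"
  using add[of f "\<lambda>\<alpha>. - g \<alpha>"] uminus[of g] algebra_uminus[of g] by simp

lemma Re: "D (\<lambda>\<alpha>. Re (\<alpha> n)) = D (coord (ReG n))"
  by (simp add: coord.simps[abs_def])

lemma Im: "D (\<lambda>\<alpha>. Im (\<alpha> n)) = D (coord (ImG n))"
  by (simp add: coord.simps[abs_def])

lemmas rules = add mult diff scale uminus const Re Im

lemma weight: "D (weight n) = Re (\<alpha> n) * D (coord (ReG n)) + Im (\<alpha> n) * D (coord (ImG n))"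
proof -
  \<comment> \<open>Square and division become a product and a scaling, for which there are
    rules.\<close>
  have "weight n
      = (\<lambda>\<alpha>. 1/2 * (1 + (Re (\<alpha> n) * Re (\<alpha> n) + Im (\<alpha> n) * Im (\<alpha> n))))"
    by (simp add: fun_eq_iff weight_def power2_eq_square)
  then have "D (weight n)
      = 1/2 * D (\<lambda>\<alpha>. 1 + (Re (\<alpha> n) * Re (\<alpha> n) + Im (\<alpha> n) * Im (\<alpha> n)))"
    by (simp only:) (rule scale, rule algebra_intros | rule algebra_intros)+
  then show ?thesis by (simp add: rules algebra_intros)
qed

lemma corr: "D (corr n) =
    Re (\<alpha> n) * D (coord (ReG (n - 1))) + Re (\<alpha> (n - 1)) * D (coord (ReG n)) +
    Im (\<alpha> n) * D (coord (ImG (n - 1))) + Im (\<alpha> (n - 1)) * D (coord (ImG n))"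
  by (simp add: corr_def[abs_def] rules algebra_intros)

lemma rot: "D (rot (ReG n)) = - D (coord (ImG n))" "D (rot (ImG n)) = D (coord (ReG n))"
  by (simp_all add: rot.simps[abs_def] rules algebra_intros)

lemma flow:
  "D (flow (ReG n)) =
     weight n \<alpha> * (D (coord (ReG (n - 1))) - D (coord (ReG (n + 1)))) +
     (Re (\<alpha> (n - 1)) - Re (\<alpha> (n + 1))) * D (weight n)"
  "D (flow (ImG n)) =
     weight n \<alpha> * (D (coord (ImG (n - 1))) - D (coord (ImG (n + 1)))) +
     (Im (\<alpha> (n - 1)) - Im (\<alpha> (n + 1))) * D (weight n)"
  by (simp_all add: flow.simps[abs_def] rules algebra_intros weight_in_algebra)

lemma pencil_upper:
  "D (pencil_upper l u v) =
     l * (rot u \<alpha> * D (flow v) + flow v \<alpha> * D (rot u) -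
       (if idx u = idx v + 1 then area u v *
         (weight (idx u) \<alpha> * D (weight (idx v)) + weight (idx v) \<alpha> * D (weight (idx u))) else 0))"
  unfolding pencil_upper_def[abs_def]
  by (simp add: rules algebra_intros weight_in_algebra rot_in_algebra flow_in_algebra)

lemma pencil:
  "D (pencil l c u v) =
     (if idx u = idx v then
        area u v * ((c - l * corr (idx u) \<alpha>) * D (weight (idx u))
          - l * (weight (idx u) \<alpha> * D (corr (idx u))))
      else if idx v < idx u then D (pencil_upper l u v)
      else - D (pencil_upper l v u))"
  unfolding pencil_def[abs_def]
  by (simp add: rules algebra_intros weight_in_algebra corr_in_algebra pencil_upper_in_algebra
      algebra_simps)

end

lemmas derivation_at_rules = derivation_at.pencil derivation_at.pencil_upper derivation_at.rot
  derivation_at.flow derivation_at.corr derivation_at.weight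

section \<open>Jacobi identity on generators\<close>

text \<open>For distinct indices the identity is polynomial in the weights as independent symbols; the relation
  between a weight and its coordinates enters only through derivatives.\<close>

lemma jacobi_gen_decreasing:
  assumes D: "\<And>u. derivation_at \<alpha> (D u)" "\<And>u v. D u (coord v) = pencil l c u v \<alpha>"
    and less: "idx w < idx v" "idx v < idx u"
  shows "D u (pencil l c v w) + D v (pencil l c w u) + D w (pencil l c u v) = 0"
proof -
  \<comment> \<open>Flows are differentiated only at \<open>idx w\<close> and \<open>idx v\<close>.
    Between these two indices, the shifted index \<open>idx w + 1\<close> or
    \<open>idx v - 1\<close> can coincide with the other index (gap 1), be adjacent to it (gap 2) or
    be apart. Between \<open>u\<close> and \<open>v\<close> only adjacency matters.\<close>
  have "idx v = idx w + 1 \<or> idx v = idx w + 2 \<or> idx w + 3 \<le> idx v"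
    and "idx u = idx v + 1 \<or> idx v + 2 \<le> idx u"
    using less by linarith+
  then show ?thesis
    by (elim disjE; cases u rule: gen.exhaust; cases v rule: gen.exhaust; cases w rule: gen.exhaust)
       (simp_all add: derivation_at_rules[OF D(1)] D(2) pencil_def pencil_upper_def corr_def algebra_simps)
qed

text \<open>Two generators with the same index either coincide, and antisymmetry kills the
  Jacobiator, or form this pair; so this settles all coinciding indices.\<close>

lemma jacobi_gen_Re_Im:
  assumes D: "\<And>u. derivation_at \<alpha> (D u)" "\<And>u v. D u (coord v) = pencil l c u v \<alpha>"
  shows "D (ReG k) (pencil l c (ImG k) w) + D (ImG k) (pencil l c w (ReG k)) +
    D w (pencil l c (ReG k) (ImG k)) = 0"
proof -
  \<comment> \<open>Eliminating squares of real parts in favour of weights brings every polynomial in the coordinates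
    and weights to a normal form.\<close>
  have sq: "Re (\<alpha> i) * Re (\<alpha> i) = 2 * weight i \<alpha> - 1 - Im (\<alpha> i) * Im (\<alpha> i)" for i
    by (simp add: weight_def power2_eq_square field_simps)
  have sq': "Re (\<alpha> i) * (Re (\<alpha> i) * x) = (2 * weight i \<alpha> - 1 - Im (\<alpha> i) * Im (\<alpha> i)) * x" for i x
    by (simp only: sq flip: mult.assoc)
  \<comment> \<open>The cases are asymmetric. Above \<open>k\<close> only adjacency to
    \<open>k\<close> matters. Below, \<open>flow w\<close> reaches up to \<open>idx w + 1\<close>
    and \<open>corr k\<close> down to \<open>k - 1\<close>, so gap 2 is special too.\<close>
  consider "idx w = k" | "idx w = k + 1" | "k + 2 \<le> idx w"
    | "idx w = k - 1" | "idx w = k - 2" | "idx w + 3 \<le> k"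
    by atomize_elim presburger
  then show ?thesis
    by cases (cases w; simp add: derivation_at_rules[OF D(1)] D(2) pencil_def pencil_upper_def corr_def;
      simp add: algebra_simps sq sq')+
qed

lemma pencil_antisym: "pencil l c u v = (\<lambda>\<alpha>. - pencil l c v u \<alpha>)"
  by (cases u; cases v) (auto simp: pencil_def fun_eq_iff)

lemma pencil_in_algebra: "pencil l c u v \<in> coord_algebra"
  unfolding pencil_def[abs_def]
  by (rule algebra_intros weight_in_algebra corr_in_algebra pencil_upper_in_algebra)+

lemma jacobi_gen:
  assumes D: "\<And>u. derivation_at \<alpha> (D u)" "\<And>u v. D u (coord v) = pencil l c u v \<alpha>"
  shows "D u (pencil l c v w) + D v (pencil l c w u) + D w (pencil l c u v) = 0"
proof -
  define J where "J u v w = D u (pencil l c v w) + D v (pencil l c w u) + D w (pencil l c u v)" for u v w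
  have flip: "D u (pencil l c v w) = - D u (pencil l c w v)" for u v w
    by (subst pencil_antisym) (rule derivation_at.uminus[OF D(1) pencil_in_algebra])
  have cyc: "J u v w = J v w u" for u v w
    by (simp add: J_def)
  have swap: "J u v w = - J v u w" for u v w
    unfolding J_def by (subst (1 2 3) flip) simp
  have dist: "J u v w = 0" if "idx w < idx v" "idx v < idx u" for u v w
    unfolding J_def using jacobi_gen_decreasing[OF D that] .
  have eq: "J u v w = 0" if "idx v = idx u" for u v w
    using that jacobi_gen_Re_Im[OF D, of "idx u" w] swap[of u v w]
    by (cases u; cases v) (simp_all add: J_def)
  have "J u v w = 0" if "idx v \<le> idx u" "idx w \<le> idx u" for u v w
  proof -
    have sorted: "J u v w = 0" if "idx w \<le> idx v" "idx v \<le> idx u" for u v w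
      using that dist[of w v u] eq[of v u w] eq[of w v u] cyc[of u v w] by linarith
    show ?thesis
      using that sorted[of w v u] sorted[of v w u] swap[of u w v] cyc[of u v w] cyc[of w u v] by linarith
  qed
  \<comment> \<open>One of the three cyclic rotations starts with a generator of largest
    index.\<close>
  from this[of v u w] this[of w v u] this[of u w v] have "J u v w = 0"
    using cyc[of u v w] cyc[of v w u] by linarith
  then show ?thesis by (simp add: J_def)
qed

section \<open>From generators to the whole algebra\<close>

lemma antisym_biderivation_onD:
  assumes "antisym_biderivation_on A B"
  shows "f \<in> A \<Longrightarrow> g \<in> A \<Longrightarrow> B f g \<in> A"
    and "f \<in> A \<Longrightarrow> g \<in> A \<Longrightarrow> B f g x = - B g f x"
    and "f \<in> A \<Longrightarrow> g \<in> A \<Longrightarrow> h \<in> A \<Longrightarrow> B (\<lambda>y. f y + g y) h x = B f h x + B g h x"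
    and "f \<in> A \<Longrightarrow> h \<in> A \<Longrightarrow> B (\<lambda>y. c * f y) h x = c * B f h x"
    and "f \<in> A \<Longrightarrow> g \<in> A \<Longrightarrow> h \<in> A \<Longrightarrow>
      B (\<lambda>y. f y * g y) h x = f x * B g h x + g x * B f h x"
  using assms unfolding antisym_biderivation_on_def by blast+

text \<open>Antisymmetry carries linearity and the Leibniz rule over to the second argument.\<close>

lemma biderivation_derivation_at:
  assumes B: "antisym_biderivation_on coord_algebra B" and h: "h \<in> coord_algebra"
  shows "derivation_at \<alpha> (\<lambda>f. B h f \<alpha>)"
proof
  note D = antisym_biderivation_onD[OF B]
  fix f g :: observable and c assume f: "f \<in> coord_algebra"
  show "B h (\<lambda>\<alpha>. c * f \<alpha>) \<alpha> = c * B h f \<alpha>"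
    using D(2)[OF h f] D(2)[OF h algebra_scale[OF f]] D(4)[OF f h] by simp
  assume g: "g \<in> coord_algebra"
  show "B h (\<lambda>\<alpha>. f \<alpha> + g \<alpha>) \<alpha> = B h f \<alpha> + B h g \<alpha>"
    using D(2)[OF h f] D(2)[OF h g] D(2)[OF h coord_algebra.add[OF f g]] D(3)[OF f g h] by simp
  show "B h (\<lambda>\<alpha>. f \<alpha> * g \<alpha>) \<alpha> = f \<alpha> * B h g \<alpha> + g \<alpha> * B h f \<alpha>"
    using D(2)[OF h f] D(2)[OF h g] D(2)[OF h coord_algebra.mult[OF f g]] D(5)[OF f g h] by simp
qed

text \<open>The Jacobiator is a derivation in its first argument, hence determined there by
  generators; cyclic symmetry gives the same for the other two.\<close>

lemma poisson_bracket_on_gen: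
  assumes B: "antisym_biderivation_on coord_algebra B"
    and gen: "\<And>u v w x. B (coord u) (B (coord v) (coord w)) x + B (coord v) (B (coord w) (coord u)) x
      + B (coord w) (B (coord u) (coord v)) x = 0"
  shows "poisson_bracket_on coord_algebra B"
proof -
  define J where "J f g h x = B f (B g h) x + B g (B h f) x + B h (B f g) x" for f g h x
  have cyc: "J f g h = J g h f" for f g h
    by (simp add: J_def fun_eq_iff)
  note closed = antisym_biderivation_onD(1)[OF B]
  note anti = antisym_biderivation_onD(2)[OF B]
  have addL: "B (\<lambda>y. f y + g y) h = (\<lambda>x. B f h x + B g h x)"
    and multL: "B (\<lambda>y. f y * g y) h = (\<lambda>x. f x * B g h x + g x * B f h x)"
    if "f \<in> coord_algebra" "g \<in> coord_algebra" "h \<in> coord_algebra" for f g h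
    using antisym_biderivation_onD(3,5)[OF B that] by (simp_all add: fun_eq_iff)
  have addR: "B h (\<lambda>y. f y + g y) = (\<lambda>x. B h f x + B h g x)"
    and multR: "B h (\<lambda>y. f y * g y) = (\<lambda>x. f x * B h g x + g x * B h f x)"
    if "f \<in> coord_algebra" "g \<in> coord_algebra" "h \<in> coord_algebra" for f g h
    using derivation_at.add[OF biderivation_derivation_at[OF B that(3)] that(1,2)]
      derivation_at.mult[OF biderivation_derivation_at[OF B that(3)] that(1,2)] by (simp_all add: fun_eq_iff)
  have constR: "B h (\<lambda>_. c) = (\<lambda>_. 0)" if "h \<in> coord_algebra" for h c
    using derivation_at.const[OF biderivation_derivation_at[OF B that]] by (simp add: fun_eq_iff)
  have constL: "B (\<lambda>_. c) h = (\<lambda>_. 0)" if "h \<in> coord_algebra" for h c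
    using anti[OF coord_algebra.const that] constR[OF that] by (simp add: fun_eq_iff)
  have ext: "J f g h x = 0"
    if f: "f \<in> coord_algebra" and gh: "g \<in> coord_algebra" "h \<in> coord_algebra"
      and base: "\<And>u. J (coord u) g h x = 0" for f g h x
    using f
  proof induction
    case (const c)
    then show ?case using gh by (simp add: J_def constL constR closed)
  next
    case (gen u)
    then show ?case using base .
  next
    case (add p q)
    then have "J (\<lambda>y. p y + q y) g h x = J p g h x + J q g h x"
      using gh by (simp add: J_def addL addR closed)
    then show ?case using add.IH by simp
  next
    case (mult p q)
    \<comment> \<open>The Leibniz rule leaves products of two brackets. Grouped this way, each
      contains a bracket plus its reverse, which cancel.\<close>
    have "J (\<lambda>y. p y * q y) g h x = p x * J q g h x + q x * J p g h x
      + B h q x * (B g p x + B p g x) + B h p x * (B g q x + B q g x)"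
      using gh mult.hyps by (simp add: J_def multL multR addR closed coord_algebra.mult algebra_simps)
    then show ?case using mult.IH anti[OF gh(1) mult.hyps(1)] anti[OF gh(1) mult.hyps(2)] by simp
  qed
  have "J f g h x = 0" if "f \<in> coord_algebra" "g \<in> coord_algebra" "h \<in> coord_algebra" for f g h x
  proof -
    have "J (coord u) (coord v) (coord w) x = 0" for u v w
      using gen by (simp add: J_def)
    \<comment> \<open>Generators give way to arbitrary elements one slot at a time, each slot being
      rotated to the front.\<close>
    then have "J h (coord u) (coord v) x = 0" for u v
      using ext that coord_algebra.gen by blast
    then have "J g h (coord u) x = 0" for u
      using ext[OF that(2,3) coord_algebra.gen] cyc by metis
    then show ?thesis
      using ext[OF that] cyc by metis
  qed
  with B show ?thesis
    unfolding poisson_bracket_on_def J_def by blast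
qed

lemma antisym_biderivation_on_lincomb:
  assumes A: "\<And>f g. f \<in> A \<Longrightarrow> g \<in> A \<Longrightarrow> (\<lambda>x. l * f x + m * g x) \<in> A"
    and "antisym_biderivation_on A B" "antisym_biderivation_on A C"
  shows "antisym_biderivation_on A (\<lambda>f g x. l * B f g x + m * C f g x)"
proof -
  note B = antisym_biderivation_onD[OF assms(2)] and C = antisym_biderivation_onD[OF assms(3)]
  show ?thesis
    unfolding antisym_biderivation_on_def
  proof (intro conjI ballI allI)
    fix f g x assume fg: "f \<in> A" "g \<in> A"
    show "(\<lambda>x. l * B f g x + m * C f g x) \<in> A"
      by (intro A B(1) C(1) fg)
    show "l * B f g x + m * C f g x = - (l * B g f x + m * C g f x)"
      by (simp add: B(2)[OF fg] C(2)[OF fg])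
  qed (simp_all add: B(3-5) C(3-5) algebra_simps)
qed

theorem theorem2p8:
  shows "compatible_on coord_algebra bracket bracket0"
  unfolding compatible_on_def
proof (intro allI)
  fix l m :: real
  define B where "B f g x = l * bracket f g x + m * bracket0 f g x" for f g x
  have B: "antisym_biderivation_on coord_algebra B"
    unfolding B_def[abs_def]
    by (intro antisym_biderivation_on_lincomb bracket_spec coord_algebra.add algebra_scale)
  have gen: "B (coord u) (coord v) = pencil l (l + 2 * m) u v" for u v
    by (simp add: B_def fun_eq_iff bracket_spec pencil_eq)
  have "poisson_bracket_on coord_algebra B"
  proof (rule poisson_bracket_on_gen[OF B])
    fix u v w x
    show "B (coord u) (B (coord v) (coord w)) x + B (coord v) (B (coord w) (coord u)) x
      + B (coord w) (B (coord u) (coord v)) x = 0"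
      \<comment> \<open>Only the inner brackets become \<open>pencil\<close>; the outer ones stay
        derivations at \<open>x\<close>.\<close>
      unfolding gen
      by (rule jacobi_gen[where D = "\<lambda>u f. B (coord u) f x"])
         (auto simp: gen intro: biderivation_derivation_at[OF B] coord_algebra.gen)
  qed
  then show "poisson_bracket_on coord_algebra (\<lambda>f g x. l * bracket f g x + m * bracket0 f g x)"
    by (simp add: B_def[abs_def])
qed

end
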